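(* Let $G$ be a graph with $n$ vertices and let $H$ be a connected graph with $m$ vertices and minimum degree $\delta(H)\ge 2$. Then $$(2-m)n+2\left\lfloor \frac{n}{m}\right\rfloor\le \gamma_{MR}(G\circ H),$$ where $G\circ H$ is the corona of $G$ and $H$.
   Context: All graphs are finite and simple. For a vertex $v$ of $G=(V,E)$, $N[v]=\{v\}\cup\{u: uv\in E\}$ is the closed neighborhood, and for $f:V\to\mathbb{R}$ and $S\subseteq V$, $f(S)=\sum_{x\in S}f(x)$. A majority Roman dominating function (MRDF) on $G$ is a function $f:V\to\{-1,1,2\}$ such that (i) $f(N[v])\ge 1$ for at least half of the vertices $v\in V$, and (ii) every vertex $u$ with $f(u)=-1$ is adjacent to at least one vertex $w$ with $f(w)=2$. The weight of $f$ is $f(V)$, and the majority Roman domination number $\gamma_{MR}(G)$ is the minimum weight of an MRDF on $G$. The corona $G_1\circ G_2$ is the graph formed from one copy of $G_1$ and $|V(G_1)|$ copies of $G_2$ by making the $i$-th vertex of $G_1$ adjacent to every vertex of the $i$-th copy of $G_2$. *)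

theory Defs
  imports Complex_Main "Graph_Theory.Graph_Theory"
begin

text \<open>
  A finite simple graph is a \<^locale>\<open>pair_graph\<close>: a finite set of vertices with a symmetric,
  irreflexive arc relation. An undirected edge \<open>uv\<close> is the pair of arcs \<open>(u, v)\<close> and \<open>(v, u)\<close>,
  so the degree of a vertex is its out-degree, and \<open>(u, v) \<in> parcs G\<close> means that \<open>u\<close> and \<open>v\<close>
  are adjacent.
\<close>

definition min_degree :: "'a pair_pre_digraph \<Rightarrow> nat" where
  "min_degree G = Min (out_degree (with_proj G) ` pverts G)"

definition closed_nbhd :: "'a pair_pre_digraph \<Rightarrow> 'a \<Rightarrow> 'a set" where
  "closed_nbhd G v = insert v {u. (u, v) \<in> parcs G}"

text \<open>
  The values of \<open>f\<close> outside the vertex set are unconstrained; they affect neither the conditions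
  below nor the weight.
\<close>

definition mrdf :: "'a pair_pre_digraph \<Rightarrow> ('a \<Rightarrow> int) \<Rightarrow> bool" where
  "mrdf G f \<longleftrightarrow>
     (\<forall>v \<in> pverts G. f v \<in> {-1, 1, 2}) \<and>
     2 * card {v \<in> pverts G. sum f (closed_nbhd G v) \<ge> 1} \<ge> card (pverts G) \<and>
     (\<forall>u \<in> pverts G. f u = -1 \<longrightarrow> (\<exists>w \<in> pverts G. (u, w) \<in> parcs G \<and> f w = 2))"

definition majority_roman_number :: "'a pair_pre_digraph \<Rightarrow> int" where
  "majority_roman_number G = Min {sum f (pverts G) | f. mrdf G f}"

text \<open>
  In the corona, \<open>Inl g\<close> is the vertex \<open>g\<close> of \<open>G\<close>, and \<open>Inr (g, h)\<close> is the vertex \<open>h\<close> of the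
  copy of \<open>H\<close> attached to \<open>g\<close>.
\<close>

definition corona ::
  "'a pair_pre_digraph \<Rightarrow> 'b pair_pre_digraph \<Rightarrow> ('a + 'a \<times> 'b) pair_pre_digraph" where
  "corona G H =
     \<lparr> pverts = pverts G <+> (pverts G \<times> pverts H),
       parcs =
         {(Inl g, Inl g') | g g'. (g, g') \<in> parcs G} \<union>
         {(Inr (g, h), Inr (g, h')) | g h h'. g \<in> pverts G \<and> (h, h') \<in> parcs H} \<union>
         {(Inl g, Inr (g, h)) | g h. g \<in> pverts G \<and> h \<in> pverts H} \<union>
         {(Inr (g, h), Inl g) | g h. g \<in> pverts G \<and> h \<in> pverts H} \<rparr>"

lemma pair_graph_corona:
  assumes "pair_graph G" and "pair_graph H"
  shows "pair_graph (corona G H)"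
proof -
  interpret G: pair_graph G by fact
  interpret H: pair_graph H by fact
  let ?C = "corona G H"
  have wf: "fst e \<in> pverts ?C \<and> snd e \<in> pverts ?C" if "e \<in> parcs ?C" for e
    using that by (auto simp: corona_def dest: G.wellformed' H.wellformed')
  have fin: "finite (pverts ?C)"
    by (simp add: corona_def G.pair_finite_verts H.pair_finite_verts)
  have "parcs ?C \<subseteq> pverts ?C \<times> pverts ?C"
    using wf by (auto simp: mem_Times_iff)
  then have fin': "finite (parcs ?C)"
    using fin by (meson finite_SigmaI finite_subset)
  have sym: "symmetric (with_proj ?C)"
    unfolding symmetric_def with_proj_simps
    by (rule symI) (auto simp: corona_def dest: G.arcs_symmetric H.arcs_symmetric)
  have loop: "fst e \<noteq> snd e" if "e \<in> parcs ?C" for e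
    using that by (auto simp: corona_def dest: G.no_loops' H.no_loops')
  show ?thesis
    using wf fin fin' sym loop by unfold_locales auto
qed

text \<open>The minimum defining \<^const>\<open>majority_roman_number\<close> is over a finite nonempty set.\<close>

lemma mrdf_one:
  assumes "pair_graph G"
  shows "mrdf G (\<lambda>_. 1)"
proof -
  interpret pair_graph G by fact
  have "card (closed_nbhd G v) \<ge> 1" if "v \<in> pverts G" for v
  proof -
    have "closed_nbhd G v \<subseteq> pverts G"
      using that by (auto simp: closed_nbhd_def dest: wellformed')
    then have "finite (closed_nbhd G v)"
      using pair_finite_verts finite_subset by blast
    then show ?thesis
      by (simp add: closed_nbhd_def card_gt_0_iff Suc_le_eq)
  qed
  then have "{v \<in> pverts G. sum (\<lambda>_. 1 :: int) (closed_nbhd G v) \<ge> 1} = pverts G"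
    by auto
  then show ?thesis
    by (simp add: mrdf_def)
qed

lemma finite_mrdf_weights:
  assumes "pair_graph G"
  shows "finite {sum f (pverts G) | f. mrdf G f}"
proof (rule finite_subset)
  show "{sum f (pverts G) | f. mrdf G f} \<subseteq> {- int (card (pverts G))..2 * int (card (pverts G))}"
  proof clarify
    fix f assume "mrdf G f"
    then have *: "-1 \<le> f v \<and> f v \<le> 2" if "v \<in> pverts G" for v
      using that by (fastforce simp: mrdf_def)
    show "sum f (pverts G) \<in> {- int (card (pverts G))..2 * int (card (pverts G))}"
      using sum_bounded_below[of "pverts G" "-1" f] sum_bounded_above[of "pverts G" f 2] *
      by auto
  qed
qed simp

lemma majority_roman_number_attained:
  assumes "pair_graph G"
  obtains f where "mrdf G f" and "sum f (pverts G) = majority_roman_number G"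
proof -
  have "majority_roman_number G \<in> {sum f (pverts G) | f. mrdf G f}"
    unfolding majority_roman_number_def
    using mrdf_one[OF assms] by (intro Min_in finite_mrdf_weights[OF assms]) auto
  then show ?thesis
    using that by auto
qed

lemma majority_roman_number_le:
  assumes "pair_graph G" and "mrdf G f"
  shows "majority_roman_number G \<le> sum f (pverts G)"
  unfolding majority_roman_number_def
  using assms(2) by (intro Min_le finite_mrdf_weights[OF assms(1)]) auto

end

theory Submission
  imports Defs
begin

text \<open>
  Split the weight of an MRDF over the blocks of the corona, a block being a vertex of \<open>G\<close> together
  with its copy of \<open>H\<close>. Every block has weight at least \<open>2 - m\<close>, and at least \<open>4 - m\<close> if its copy
  of \<open>H\<close> contains a vertex whose closed neighbourhood has positive weight. If there are \<open>k\<close> blocks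
  of the latter kind, at most \<open>n + m k\<close> vertices have a closed neighbourhood of positive weight,
  even when all vertices of \<open>G\<close> do. Hence \<open>2 (n + m k) \<ge> n (m + 1)\<close>, and \<open>m \<ge> 3\<close> yields
  \<open>m k \<ge> n\<close>.
\<close>

lemma (in pair_graph) closed_nbhd_subset:
  "v \<in> pverts G \<Longrightarrow> closed_nbhd G v \<subseteq> pverts G"
  by (auto simp: closed_nbhd_def dest: wellformed')

text \<open>The degree counts arcs leaving \<open>v\<close>, the neighbourhood collects arcs
  entering it; symmetry matches the two. The extra one is \<open>v\<close> itself, which is not its
  own neighbour.\<close>

lemma (in pair_graph) card_closed_nbhd_ge:
  assumes "v \<in> pverts G"
  shows "card (closed_nbhd G v) \<ge> Suc (min_degree G)"
proof -
  let ?N = "{u. (u, v) \<in> parcs G}"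
  have "out_arcs (with_proj G) v = Pair v ` ?N"
    by (auto simp: out_arcs_def dest: arcs_symmetric)
  then have "out_degree (with_proj G) v = card ?N"
    by (simp add: out_degree_def card_image inj_on_def)
  moreover have "finite ?N"
    using pair_finite_verts by (rule rev_finite_subset) (auto dest: wellformed')
  moreover have "v \<notin> ?N"
    using no_loops' by auto
  moreover have "min_degree G \<le> out_degree (with_proj G) v"
    unfolding min_degree_def using assms by (intro Min_le) auto
  ultimately show ?thesis
    by (simp add: closed_nbhd_def)
qed

text \<open>Here \<open>c\<close> is the value at the vertex of the other factor that is joined to all of \<open>H\<close>.\<close>

lemma cone_weight:
  fixes a :: "'b \<Rightarrow> int" and c :: int
  assumes "pair_graph H" "min_degree H \<ge> 2" "pverts H \<noteq> {}"
    and c: "c \<in> {-1, 1, 2}" and a: "\<forall>h \<in> pverts H. a h \<in> {-1, 1, 2}"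
    and defended: "\<forall>u \<in> pverts H. a u = -1 \<longrightarrow> c = 2 \<or> (\<exists>w \<in> pverts H. a w = 2)"
  shows "c + sum a (pverts H) \<ge> 2 - int (card (pverts H))"
    and "\<lbrakk>h \<in> pverts H; c + sum a (closed_nbhd H h) \<ge> 1\<rbrakk>
      \<Longrightarrow> c + sum a (pverts H) \<ge> 4 - int (card (pverts H))"
proof -
  interpret H: pair_graph H by fact
  let ?V = "pverts H" and ?N = "closed_nbhd H"
  \<comment> \<open>Adding 1 turns the values -1, 1, 2 into 0, 2, 3. All terms are then nonnegative,
    so \<open>s\<close> is monotone in the set, which \<open>sum a\<close> is not.\<close>
  define s where "s A = (\<Sum>x\<in>A. a x + 1)" for A
  have s_eq: "s A = sum a A + int (card A)" for A
    by (simp add: s_def sum.distrib)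
  have nonneg: "a x + 1 \<ge> 0" if "x \<in> ?V" for x
    using bspec[OF a that] by auto
  have mono: "s A \<le> s ?V" if "A \<subseteq> ?V" for A
    unfolding s_def using that nonneg by (intro sum_mono2) auto
  have point: "a x + 1 \<le> s ?V" if "x \<in> ?V" for x
    using mono[of "{x}"] that by (simp add: s_def)
  have N_card: "int (card (?N h)) \<ge> 3" if "h \<in> ?V" for h
    using H.card_closed_nbhd_ge[OF that] assms(2) by simp
  have N_sub: "?N h \<subseteq> ?V" if "h \<in> ?V" for h
    using that by (rule H.closed_nbhd_subset)
  have V_card: "int (card ?V) \<ge> 3"
  proof -
    obtain h where "h \<in> ?V" using assms(3) by blast
    then show ?thesis
      using N_card[of h] card_mono[OF H.pair_finite_verts N_sub[of h]] by linarith
  qed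
  \<comment> \<open>Without help from \<open>c\<close>, a vertex of value -1 needs a vertex of value
    2 in \<open>H\<close>, whose term alone is 3. If no value is -1, each of the at least three
    terms is at least 1.\<close>
  have s_ge: "s ?V \<ge> 3" if c': "c \<noteq> 2"
  proof (cases "\<exists>u \<in> ?V. a u = -1")
    case True
    then obtain u where "u \<in> ?V" "a u = -1" by auto
    then obtain w where "w \<in> ?V" "a w = 2" using defended c' by auto
    then show ?thesis using point[of w] by simp
  next
    case False
    then have "1 \<le> a x + 1" if "x \<in> ?V" for x
      using bspec[OF a that] that by auto
    then have "int (card ?V) * 1 \<le> s ?V"
      unfolding s_def by (intro sum_bounded_below) auto
    then show ?thesis using V_card by simp
  qed
  have s_nonneg: "s ?V \<ge> 0"
    unfolding s_def by (intro sum_nonneg nonneg)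
  \<comment> \<open>In both cases \<open>c + s ?V\<close> is at least 2: either \<open>c = 2\<close>
    and \<open>s ?V\<close> is nonnegative, or \<open>c\<close> is at least -1 and
    \<open>s ?V\<close> at least 3.\<close>
  show "c + sum a ?V \<ge> 2 - int (card ?V)"
    using c s_ge s_nonneg s_eq[of ?V] by auto
  assume h: "h \<in> ?V" and pos: "c + sum a (?N h) \<ge> 1"
  \<comment> \<open>On the neighbourhood, \<open>sum a\<close> is at least \<open>1 - c\<close>, and
    its at least three vertices add 3 to \<open>s\<close>; monotonicity carries this over to
    \<open>?V\<close>.\<close>
  have bound: "s ?V \<ge> 4 - c"
    using mono[OF N_sub[OF h]] s_eq[of "?N h"] N_card[OF h] pos by linarith
  then show "c + sum a ?V \<ge> 4 - int (card ?V)"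
    using s_eq[of ?V] by linarith
qed

lemma sum_corona:
  fixes f :: "'a + 'a \<times> 'b \<Rightarrow> 'c :: comm_monoid_add"
  assumes "finite (pverts G)" "finite (pverts H)"
  shows "sum f (pverts (corona G H)) =
    (\<Sum>g\<in>pverts G. f (Inl g) + (\<Sum>h\<in>pverts H. f (Inr (g, h))))"
  using assms by (simp add: corona_def sum.Plus sum.distrib sum.cartesian_product o_def)

text \<open>A vertex in a copy of \<open>H\<close> has no neighbours outside its own block, so its
  condition can be checked within that block.\<close>

lemma sum_closed_nbhd_corona_Inr:
  fixes f :: "'a + 'a \<times> 'b \<Rightarrow> 'c :: comm_monoid_add"
  assumes "pair_graph H" "g \<in> pverts G" "h \<in> pverts H"
  shows "sum f (closed_nbhd (corona G H) (Inr (g, h))) =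
    f (Inl g) + (\<Sum>x\<in>closed_nbhd H h. f (Inr (g, x)))"
proof -
  interpret H: pair_graph H by fact
  have "closed_nbhd (corona G H) (Inr (g, h)) =
      insert (Inl g) ((\<lambda>x. Inr (g, x)) ` closed_nbhd H h)"
    using assms by (auto simp: closed_nbhd_def corona_def)
  moreover have "finite (closed_nbhd H h)"
    using H.closed_nbhd_subset[OF assms(3)] H.pair_finite_verts by (rule finite_subset)
  ultimately show ?thesis
    by (subst \<open>closed_nbhd (corona G H) _ = _\<close>, subst sum.insert)
      (auto simp: sum.reindex inj_on_def)
qed

theorem theorem21:
  fixes G :: "'a pair_pre_digraph" and H :: "'b pair_pre_digraph" and n m :: nat
  assumes "pair_graph G" and "card (pverts G) = n"
    and "pair_graph H" and "card (pverts H) = m"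
    and "Digraph_Component.connected (with_proj H)"
    and "min_degree H \<ge> 2"
  shows "(2 - int m) * int n + 2 * \<lfloor>real n / real m\<rfloor> \<le> majority_roman_number (corona G H)"
proof -
  interpret G: pair_graph G by fact
  interpret H: pair_graph H by fact
  let ?C = "corona G H"
  \<comment> \<open>Connectedness includes having a vertex.\<close>
  have H_ne: "pverts H \<noteq> {}"
    using assms(5) by (auto simp: connected_def strongly_connected_def)
  have m: "m \<ge> 3"
  proof -
    obtain h where h: "h \<in> pverts H" using H_ne by blast
    show ?thesis
      using H.card_closed_nbhd_ge[OF h] card_mono[OF H.pair_finite_verts H.closed_nbhd_subset[OF h]]
        assms(4,6) by linarith
  qed
  obtain f where f: "mrdf ?C f" and weight: "sum f (pverts ?C) = majority_roman_number ?C"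
    using majority_roman_number_attained[OF pair_graph_corona[OF assms(1,3)]] .
  define good where "good = {v \<in> pverts ?C. sum f (closed_nbhd ?C v) \<ge> 1}"
  define K where "K = {g \<in> pverts G. \<exists>h \<in> pverts H. Inr (g, h) \<in> good}"
  define w where "w g = f (Inl g) + (\<Sum>h\<in>pverts H. f (Inr (g, h)))" for g
  have K: "K \<subseteq> pverts G" "finite K"
    by (auto simp: K_def)

  have w_ge: "w g \<ge> 2 - int m + (if g \<in> K then 2 else 0)" if g: "g \<in> pverts G" for g
  proof -
    have c: "f (Inl g) \<in> {-1, 1, 2}" and a: "\<forall>h \<in> pverts H. f (Inr (g, h)) \<in> {-1, 1, 2}"
      using f g by (auto simp: mrdf_def corona_def)
    \<comment> \<open>The defender of a vertex in the copy at \<open>g\<close> is either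
      \<open>Inl g\<close> or lies in the same copy.\<close>
    have d: "\<forall>u \<in> pverts H. f (Inr (g, u)) = -1 \<longrightarrow>
      f (Inl g) = 2 \<or> (\<exists>x \<in> pverts H. f (Inr (g, x)) = 2)"
    proof (intro ballI impI)
      fix u
      assume u: "u \<in> pverts H" "f (Inr (g, u)) = -1"
      have "Inr (g, u) \<in> pverts ?C" using u(1) g by (auto simp: corona_def)
      then obtain x where "(Inr (g, u), x) \<in> parcs ?C" "f x = 2"
        using f u(2) unfolding mrdf_def by blast
      then show "f (Inl g) = 2 \<or> (\<exists>x \<in> pverts H. f (Inr (g, x)) = 2)"
        by (auto simp: corona_def dest: H.wellformed')
    qed
    note cone = cone_weight[OF assms(3,6) H_ne c a d]
    show ?thesis
    proof (cases "g \<in> K")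
      case True
      then obtain h where h: "h \<in> pverts H" "Inr (g, h) \<in> good" by (auto simp: K_def)
      then have "f (Inl g) + (\<Sum>x\<in>closed_nbhd H h. f (Inr (g, x))) \<ge> 1"
        using sum_closed_nbhd_corona_Inr[OF assms(3) g h(1), of f] by (auto simp: good_def)
      then show ?thesis
        using cone(2)[OF h(1)] True assms(4) by (simp add: w_def)
    next
      case False
      then show ?thesis using cone(1) assms(4) by (simp add: w_def)
    qed
  qed

  have "card (pverts ?C) = n + n * m"
    using assms by (simp add: corona_def card_Plus card_cartesian_product)
  then have "n + n * m \<le> 2 * card good"
    using f by (simp add: mrdf_def good_def)
  moreover have "card good \<le> n + card K * m"
  proof -
    have "good \<subseteq> pverts G <+> (K \<times> pverts H)"
      by (auto simp: good_def K_def corona_def)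
    then have "card good \<le> card (pverts G <+> (K \<times> pverts H))"
      using K by (intro card_mono) auto
    then show ?thesis
      using K assms by (simp add: card_Plus card_cartesian_product)
  qed
  \<comment> \<open>The two counts combine to \<open>n * m - n \<le> 2 * card K * m\<close>; the
    left side is at least \<open>2 * n\<close> once \<open>m\<close> is at least 3.\<close>
  moreover have "n * 3 \<le> n * m"
    using m by simp
  ultimately have "n \<le> card K * m"
    by linarith
  then have "real n \<le> real (card K) * real m"
    by (metis of_nat_le_iff of_nat_mult)
  then have "real n / real m \<le> real (card K)"
    using m by (simp add: divide_le_eq)
  then have floor: "\<lfloor>real n / real m\<rfloor> \<le> int (card K)"
    by linarith

  have "(\<Sum>g\<in>pverts G. 2 - int m + (if g \<in> K then 2 else 0)) \<le> sum w (pverts G)"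
    by (intro sum_mono w_ge)
  moreover have "(\<Sum>g\<in>pverts G. 2 - int m + (if g \<in> K then 2 else 0)) =
      (2 - int m) * int n + 2 * int (card K)"
    using K assms(2) by (simp add: sum.distrib sum.If_cases Int_absorb1 mult.commute)
  moreover have "sum w (pverts G) = majority_roman_number ?C"
    using weight by (simp add: sum_corona w_def)
  ultimately show ?thesis
    using floor by linarith
qed

end
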